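(* Let $I$ be a finite index set, let $g_i\in\mathbb{Z}[X]$ for $i\in I$, let $d$ be a positive integer, and suppose that $$f(X)=\frac{\prod_{i\in I}g_i(X)}{d}$$ belongs to $\mathrm{Int}(\mathbb{Z})$. Let $p$ be a prime factor of $d$ such that $p\parallel d$ (that is, $p\mid d$ and $p^2\nmid d$). Then $f(X)$ is $p$-image primitive if and only if the following condition holds: there exist $\overline{j}\in\{0,\ldots,p-1\}$ and $\overline{i}\in I$ such that $g_{\overline{i}}\in\mathcal{M}_{p,\overline{j}}\setminus\mathcal{M}_{p,\overline{j}}^2$ and, for all $i\in I$ with $i\neq\overline{i}$, $g_i\notin\mathcal{M}_{p,\overline{j}}$. Moreover, if that condition holds (for some $\overline{j}$ and $\overline{i}$), then $\overline{i}\in J$ for every minimal $p$-covering $J\subseteq I$ for $\{g_i\}_{i\in I}$.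
   Context: $\mathrm{Int}(\mathbb{Z})=\{f\in\mathbb{Q}[X] : f(\mathbb{Z})\subset\mathbb{Z}\}$ is the ring of integer-valued polynomials. For $f\in\mathrm{Int}(\mathbb{Z})$, the fixed divisor $d(f)$ is the g.c.d. of the set $\{f(n): n\in\mathbb{Z}\}$. For a prime $p$, $f\in\mathrm{Int}(\mathbb{Z})$ is called $p$-image primitive if $p$ does not divide $d(f)$. For a prime $p$ and $j\in\{0,\ldots,p-1\}$, $\mathcal{M}_{p,j}=(p,X-j)=\{g\in\mathbb{Z}[X] : p\mid g(j)\}$, a maximal ideal of $\mathbb{Z}[X]$ (these are the primary components of the ideal $I_p=p\,\mathrm{Int}(\mathbb{Z})\cap\mathbb{Z}[X]$); $\mathcal{M}_{p,j}^2$ denotes the square of this ideal. For $g\in\mathbb{Z}[X]$ set $C_{p,g}=\{j\in\{0,\ldots,p-1\} : p\mid g(j)\}$. Given a family $\{g_i\}_{i\in I}$ of polynomials in $\mathbb{Z}[X]$, a $p$-covering for it is a subset $J\subseteq I$ such that $\bigcup_{i\in J}C_{p,g_i}=\{0,\ldots,p-1\}$ (with the convention that $C_{p,g_i}\neq\emptyset$ for each $i\in J$); it is minimal if no proper subset of $J$ is a $p$-covering. *)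

theory Defs
  imports
    "HOL-Algebra.Ideal_Product"
    "HOL-Algebra.Algebraic_Closure_Type"
    "HOL-Computational_Algebra.Computational_Algebra"
begin

text \<open>Elements of \<open>Int(\<int>)\<close> are kept as rational polynomials.\<close>

definition Int_Z :: "rat poly set" where
  "Int_Z = {f. \<forall>n::int. poly f (of_int n) \<in> \<int>}"

text \<open>The set under the \<open>Gcd\<close> is \<open>f(\<int>)\<close>, pulled back from the rationals to the integers;
  for \<open>f\<close> in \<open>Int_Z\<close> no value is lost. In particular the fixed divisor of \<open>0\<close> is \<open>0\<close>.\<close>

definition fixed_divisor :: "rat poly \<Rightarrow> int" where
  "fixed_divisor f = Gcd {k::int. \<exists>n::int. poly f (of_int n) = of_int k}"

definition p_image_primitive :: "int \<Rightarrow> rat poly \<Rightarrow> bool" where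
  "p_image_primitive p f \<longleftrightarrow> f \<in> Int_Z \<and> \<not> p dvd fixed_divisor f"

abbreviation ZX :: "int poly ring" where
  "ZX \<equiv> ring_of_type_algebra"

definition ideal_M :: "int \<Rightarrow> int \<Rightarrow> int poly set" where
  "ideal_M p j = genideal ZX {[:p:], [:- j, 1:]}"

definition ideal_M_sq :: "int \<Rightarrow> int \<Rightarrow> int poly set" where
  "ideal_M_sq p j = ideal_prod ZX (ideal_M p j) (ideal_M p j)"

lemma ideal_M_iff: "g \<in> ideal_M p j \<longleftrightarrow> p dvd poly g j"
proof -
  interpret R: cring ZX by (rule cring_from_type_algebra)
  have simps: "carrier ZX = UNIV" "\<And>x y. x \<otimes>\<^bsub>ZX\<^esub> y = x * y" "\<And>x y. x \<oplus>\<^bsub>ZX\<^esub> y = x + y"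
    by (auto simp: ring_of_type_algebra_def)
  have sub: "{[:p:], [:- j, 1:]} \<subseteq> ideal_M p j"
    unfolding ideal_M_def by (rule R.genideal_self) (simp add: simps)
  have idM: "ideal (ideal_M p j) ZX"
    unfolding ideal_M_def by (rule R.genideal_ideal) (simp add: simps)
  show ?thesis
  proof
    have "ideal {h::int poly. p dvd poly h j} ZX"
    proof (rule idealI)
      show "ring ZX" by (rule R.ring_axioms)
      show "subgroup {h::int poly. p dvd poly h j} (add_monoid ZX)"
      proof (rule R.add.subgroupI)
        fix a :: "int poly" assume a: "a \<in> {h. p dvd poly h j}"
        have "\<ominus>\<^bsub>ZX\<^esub> a = - a"
          by (rule R.minus_equality)
             (simp_all add: ring_of_type_algebra_def)
        then show "\<ominus>\<^bsub>ZX\<^esub> a \<in> {h. p dvd poly h j}" using a by simp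
      qed (auto simp: simps intro: exI[of _ 0])
    qed (auto simp: simps)
    then have "ideal_M p j \<subseteq> {h. p dvd poly h j}"
      unfolding ideal_M_def by (rule R.genideal_minimal) simp
    then show "g \<in> ideal_M p j \<Longrightarrow> p dvd poly g j" by auto
  next
    assume "p dvd poly g j"
    then obtain c where c: "poly g j = p * c" by blast
    have "[:- j, 1:] dvd g - [:poly g j:]"
      by (simp add: poly_eq_0_iff_dvd [symmetric])
    then obtain q where q: "g - [:poly g j:] = [:- j, 1:] * q" by blast
    have "g = [:poly g j:] + (g - [:poly g j:])" by simp
    also have "\<dots> = [:c:] * [:p:] + q * [:- j, 1:]"
      unfolding q by (simp add: c mult.commute)
    finally have g: "g = ([:c:] \<otimes>\<^bsub>ZX\<^esub> [:p:]) \<oplus>\<^bsub>ZX\<^esub> (q \<otimes>\<^bsub>ZX\<^esub> [:- j, 1:])" by (simp only: simps)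
    show "g \<in> ideal_M p j"
      unfolding g
      by (intro additive_subgroup.a_closed[OF ideal.axioms(1)[OF idM]] ideal.I_l_closed[OF idM])
         (use sub in \<open>auto simp only: simps\<close>)
  qed
qed

definition C_set :: "int \<Rightarrow> int poly \<Rightarrow> int set" where
  "C_set p g = {j \<in> {0..<p}. p dvd poly g j}"

definition p_covering :: "int \<Rightarrow> 'i set \<Rightarrow> ('i \<Rightarrow> int poly) \<Rightarrow> 'i set \<Rightarrow> bool" where
  "p_covering p I g J \<longleftrightarrow>
     J \<subseteq> I \<and> (\<forall>i\<in>J. C_set p (g i) \<noteq> {}) \<and> (\<Union>i\<in>J. C_set p (g i)) = {0..<p}"

definition minimal_p_covering :: "int \<Rightarrow> 'i set \<Rightarrow> ('i \<Rightarrow> int poly) \<Rightarrow> 'i set \<Rightarrow> bool" where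
  "minimal_p_covering p I g J \<longleftrightarrow>
     p_covering p I g J \<and> (\<forall>J'. J' \<subset> J \<longrightarrow> \<not> p_covering p I g J')"

end

theory Submission
  imports Defs
begin

text \<open>Since \<open>p\<close> divides \<open>d\<close> exactly once, \<open>f\<close> is \<open>p\<close>-image primitive iff \<open>p\<^sup>2\<close> fails to divide
  \<open>\<Prod>i\<in>I. g i\<close> at some integer \<open>n\<close>, i.e. iff exactly one factor is divisible by \<open>p\<close> at \<open>n\<close>, and
  that one not by \<open>p\<^sup>2\<close>. With \<open>j = n mod p\<close> this becomes the stated condition, because the square
  of the ideal \<open>(p, X - j)\<close> consists of the polynomials divisible by \<open>p\<^sup>2\<close> on the whole class of
  \<open>j\<close> modulo \<open>p\<close>.\<close>

lemma poly_map_poly_of_int: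
  "poly (map_poly of_int G) (of_int n) = (of_int (poly G n) :: 'a :: comm_ring_1)"
  by (induction G) (auto simp: map_poly_pCons)

lemma poly_remainder:
  fixes g :: "'a :: comm_ring_1 poly"
  obtains q where "g = [:poly g a:] + [:- a, 1:] * q"
proof -
  have "[:- a, 1:] dvd g - [:poly g a:]"
    by (simp add: poly_eq_0_iff_dvd [symmetric])
  then obtain q where "g - [:poly g a:] = [:- a, 1:] * q" by blast
  then show thesis using that[of q] by (metis add.commute diff_add_cancel)
qed

text \<open>After the value at \<open>j\<close> is split off, the rest is a multiple of X -
  \<open>j\<close>, hence divisible by \<open>p\<close> at every \<open>j + p * k\<close>.\<close>

lemma dvd_poly_add_mult_iff:
  fixes p :: int
  shows "p dvd poly g (j + p * k) \<longleftrightarrow> p dvd poly g j"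
proof -
  obtain q where g: "g = [:poly g j:] + [:- j, 1:] * q" by (rule poly_remainder)
  have "poly g (j + p * k) = poly g j + p * (k * poly q (j + p * k))"
    by (subst g) (simp add: algebra_simps)
  then show ?thesis by (simp add: dvd_add_left_iff)
qed

lemma ideal_M_sq_iff:
  assumes "p \<noteq> 0"
  shows "g \<in> ideal_M_sq p j \<longleftrightarrow> (\<forall>k. p\<^sup>2 dvd poly g (j + p * k))"
proof
  assume "g \<in> ideal_M_sq p j"
  then have "g \<in> ideal_prod ZX (ideal_M p j) (ideal_M p j)"
    by (simp add: ideal_M_sq_def)
  then show "\<forall>k. p\<^sup>2 dvd poly g (j + p * k)"
  proof induction
    case (prod a b)
    then show ?case
      by (auto simp: ring_of_type_algebra_def power2_eq_square ideal_M_iff dvd_poly_add_mult_iff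
          intro!: mult_dvd_mono)
  next
    case (sum a b)
    then show ?case by (auto simp: ring_of_type_algebra_def)
  qed
next
  assume R: "\<forall>k. p\<^sup>2 dvd poly g (j + p * k)"
  define x where "x = [:- j, 1:]"
  obtain h where h: "g = [:poly g j:] + x * h" unfolding x_def by (rule poly_remainder)
  obtain q where q: "h = [:poly h j:] + x * q" unfolding x_def by (rule poly_remainder)
  have g: "g = [:poly g j:] + x * ([:poly h j:] + x * q)"
    using h q by metis
  obtain a where a: "poly g j = p\<^sup>2 * a" using R[rule_format, of 0] by auto
  have "p\<^sup>2 dvd poly g (j + p * 1)" using R by blast
  also have "poly g (j + p * 1) = p\<^sup>2 * (a + poly q (j + p)) + p * poly h j"
    by (subst g) (simp add: a x_def algebra_simps power2_eq_square)
  finally have "p * p dvd p * poly h j"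
    by (simp add: dvd_add_right_iff power2_eq_square)
  then obtain b where b: "poly h j = p * b" using assms by auto
  \<comment> \<open>The expansion is regrouped so that each summand is a product of two members of
    (p, X - j); the right nesting fits \<open>mem_add\<close>.\<close>
  have g': "g = [:p:] * [:p * a:] + ([:p:] * ([:b:] * x) + x * (x * q))"
    by (subst g) (simp add: a b algebra_simps power2_eq_square)
  have mem: "u * v \<in> ideal_M_sq p j"
    if "u \<in> ideal_M p j" "v \<in> ideal_M p j" for u v
    using that ideal_prod.prod[of u "ideal_M p j" v "ideal_M p j" ZX] unfolding ideal_M_sq_def
    by (simp add: ring_of_type_algebra_def)
  have mem_add: "u * v + w \<in> ideal_M_sq p j"
    if "u \<in> ideal_M p j" "v \<in> ideal_M p j" "w \<in> ideal_M_sq p j" for u v w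
    using that ideal_prod.sum[of "u * v" ZX "ideal_M p j" "ideal_M p j" w] mem[OF that(1,2)]
    unfolding ideal_M_sq_def by (simp add: ring_of_type_algebra_def)
  show "g \<in> ideal_M_sq p j"
    by (subst g') (intro mem_add mem; simp add: ideal_M_iff x_def)
qed

text \<open>The p-adic valuation of the product is the sum of those of the factors, and a sum of
  naturals is 1 only if one term is 1 and the others are 0.\<close>

lemma prime_square_not_dvd_prod_iff:
  fixes p :: int
  assumes "finite I" and p: "Factorial_Ring.prime p"
  shows "p dvd prod a I \<and> \<not> p\<^sup>2 dvd prod a I \<longleftrightarrow>
    (\<exists>i0\<in>I. p dvd a i0 \<and> \<not> p\<^sup>2 dvd a i0 \<and> (\<forall>i\<in>I. i \<noteq> i0 \<longrightarrow> \<not> p dvd a i))"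
    (is "?L \<longleftrightarrow> ?R")
proof
  assume L: ?L
  then obtain i0 where i0: "i0 \<in> I" "p dvd a i0"
    using prime_dvd_prod_iff assms by blast
  have eq: "prod a I = a i0 * prod a (I - {i0})"
    using assms(1) i0(1) by (rule prod.remove)
  have "\<not> p dvd prod a (I - {i0})"
    using L i0(2) unfolding eq power2_eq_square by (blast intro: mult_dvd_mono)
  moreover have "\<not> p\<^sup>2 dvd a i0" using L unfolding eq by (metis dvd_mult2)
  ultimately show ?R using i0 assms(1) by (auto simp: prime_dvd_prod_iff[OF _ p])
next
  assume ?R
  then obtain i0 where i0: "i0 \<in> I" "p dvd a i0" "\<not> p\<^sup>2 dvd a i0"
    and others: "\<forall>i\<in>I. i \<noteq> i0 \<longrightarrow> \<not> p dvd a i" by blast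
  have eq: "prod a I = a i0 * prod a (I - {i0})"
    using assms(1) i0(1) by (rule prod.remove)
  have "\<not> p dvd prod a (I - {i0})"
    using others assms(1) by (auto simp: prime_dvd_prod_iff[OF _ p])
  then have "coprime (p\<^sup>2) (prod a (I - {i0}))"
    using p by (simp add: prime_imp_coprime)
  then show ?L using i0 by (simp add: eq coprime_dvd_mult_left_iff)
qed

text \<open>\<open>p\<close> misses the gcd of the values iff it misses some value
  \<open>poly G n / d\<close>. As \<open>d\<close> has p-adic valuation 1, this says that
  \<open>poly G n\<close> has valuation 1, the form \<open>prime_square_not_dvd_prod_iff\<close>
  treats.\<close>

lemma p_image_primitive_iff:
  fixes G :: "int poly"
  assumes "d \<noteq> 0" and f: "f = smult (1 / of_int d) (map_poly of_int G)"
    and "f \<in> Int_Z" and p: "Factorial_Ring.prime p" and "p dvd d" "\<not> p\<^sup>2 dvd d"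
  shows "p_image_primitive p f \<longleftrightarrow> (\<exists>n. p dvd poly G n \<and> \<not> p\<^sup>2 dvd poly G n)"
proof -
  have val: "poly f (of_int n) = of_int k \<longleftrightarrow> poly G n = d * k" for n k
  proof -
    have "poly f (of_int n) = of_int (poly G n) / of_int d"
      by (simp add: f poly_map_poly_of_int)
    also have "\<dots> = of_int k \<longleftrightarrow> (of_int (poly G n) :: rat) = of_int (d * k)"
      using assms(1) by (simp add: field_simps)
    finally show ?thesis by (simp only: of_int_eq_iff)
  qed
  have ex: "\<exists>k. poly G n = d * k" for n
  proof -
    have "poly f (of_int n) \<in> \<int>" using assms(3) by (simp add: Int_Z_def)
    then show ?thesis by (metis Ints_cases val)
  qed
  obtain m where m: "d = p * m" using assms by blast
  \<comment> \<open>Cancelling one \<open>p\<close> from \<open>d * k\<close> leaves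
    \<open>m * k\<close>, where \<open>m\<close> is prime to \<open>p\<close>.\<close>
  have "\<not> p dvd m" using assms(6) by (auto simp: m power2_eq_square)
  then have dvd: "p\<^sup>2 dvd d * k \<longleftrightarrow> p dvd k" for k
    using p by (auto simp: m power2_eq_square mult.assoc prime_dvd_mult_iff)
  have "p_image_primitive p f \<longleftrightarrow> (\<exists>n k. poly G n = d * k \<and> \<not> p dvd k)"
    using assms(3) by (auto simp: p_image_primitive_def fixed_divisor_def val dvd_Gcd_iff)
  also have "\<dots> \<longleftrightarrow> (\<exists>n. p dvd poly G n \<and> \<not> p\<^sup>2 dvd poly G n)"
  proof
    assume "\<exists>n k. poly G n = d * k \<and> \<not> p dvd k"
    then show "\<exists>n. p dvd poly G n \<and> \<not> p\<^sup>2 dvd poly G n"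
      using dvd assms(5) by (metis dvd_mult2)
  next
    assume "\<exists>n. p dvd poly G n \<and> \<not> p\<^sup>2 dvd poly G n"
    then show "\<exists>n k. poly G n = d * k \<and> \<not> p dvd k"
      using dvd ex by metis
  qed
  finally show ?thesis .
qed

theorem lemma2p2:
  fixes I :: "'i set" and g :: "'i \<Rightarrow> int poly" and d p :: int and f :: "rat poly"
  assumes "finite I"
    and "d > 0"
    and "f = smult (1 / of_int d) (map_poly of_int (\<Prod>i\<in>I. g i))"
    and "f \<in> Int_Z"
    and "Factorial_Ring.prime p"
    and "p dvd d" and "\<not> p\<^sup>2 dvd d"
  shows "(p_image_primitive p f \<longleftrightarrow>
           (\<exists>j0\<in>{0..<p}. \<exists>i0\<in>I. g i0 \<in> ideal_M p j0 - ideal_M_sq p j0 \<and>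
              (\<forall>i\<in>I. i \<noteq> i0 \<longrightarrow> g i \<notin> ideal_M p j0))) \<and>
         (\<forall>j0\<in>{0..<p}. \<forall>i0\<in>I. g i0 \<in> ideal_M p j0 - ideal_M_sq p j0 \<and>
              (\<forall>i\<in>I. i \<noteq> i0 \<longrightarrow> g i \<notin> ideal_M p j0) \<longrightarrow>
              (\<forall>J. minimal_p_covering p I g J \<longrightarrow> i0 \<in> J))"
proof (intro conjI ballI impI allI)
  have p0: "p > 0" using assms(5) by (rule prime_gt_0_int)
  \<comment> \<open>Splitting \<open>n\<close> into its residue \<open>j\<close> and quotient
    \<open>k\<close> separates what depends on the class alone from what depends on the
    representative.\<close>
  have residue: "(\<exists>n. P n) \<longleftrightarrow> (\<exists>j\<in>{0..<p}. \<exists>k. P (j + p * k))" for P :: "int \<Rightarrow> bool"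
  proof
    assume "\<exists>n. P n"
    then obtain n where "P (n mod p + p * (n div p))" by auto
    moreover have "n mod p \<in> {0..<p}" using p0 by simp
    ultimately show "\<exists>j\<in>{0..<p}. \<exists>k. P (j + p * k)" by blast
  qed blast
  have "p_image_primitive p f \<longleftrightarrow> (\<exists>n. \<exists>i0\<in>I. p dvd poly (g i0) n \<and>
      \<not> p\<^sup>2 dvd poly (g i0) n \<and> (\<forall>i\<in>I. i \<noteq> i0 \<longrightarrow> \<not> p dvd poly (g i) n))"
    unfolding p_image_primitive_iff[OF less_imp_neq[OF assms(2), symmetric] assms(3-7)]
    by (simp add: poly_prod prime_square_not_dvd_prod_iff[OF assms(1,5)])
  also have "\<dots> \<longleftrightarrow> (\<exists>j0\<in>{0..<p}. \<exists>i0\<in>I. g i0 \<in> ideal_M p j0 - ideal_M_sq p j0 \<and>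
      (\<forall>i\<in>I. i \<noteq> i0 \<longrightarrow> g i \<notin> ideal_M p j0))"
    using p0 by (subst residue) (simp add: ideal_M_iff ideal_M_sq_iff dvd_poly_add_mult_iff, blast)
  finally show "p_image_primitive p f \<longleftrightarrow>
      (\<exists>j0\<in>{0..<p}. \<exists>i0\<in>I. g i0 \<in> ideal_M p j0 - ideal_M_sq p j0 \<and>
        (\<forall>i\<in>I. i \<noteq> i0 \<longrightarrow> g i \<notin> ideal_M p j0))" .
next
  fix j0 i0 J
  assume j0: "j0 \<in> {0..<p}"
    and "g i0 \<in> ideal_M p j0 - ideal_M_sq p j0 \<and> (\<forall>i\<in>I. i \<noteq> i0 \<longrightarrow> g i \<notin> ideal_M p j0)"
    and J: "minimal_p_covering p I g J"
  then have others: "i = i0" if "i \<in> I" "p dvd poly (g i) j0" for i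
    using that by (auto simp: ideal_M_iff)
  \<comment> \<open>Some index of \<open>J\<close> must cover the residue \<open>j0\<close>, and
    only \<open>i0\<close> can.\<close>
  have "j0 \<in> (\<Union>i\<in>J. C_set p (g i))" and "J \<subseteq> I"
    using j0 J by (auto simp: minimal_p_covering_def p_covering_def)
  then show "i0 \<in> J" using others by (auto simp: C_set_def)
qed

end
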